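(* For every fixed integer $n\geq 2$, as $t\to\infty$, $$t^2(\log t)^{n-1}\ll R_n^s(t)\ll t^2(\log t)^{n-1},$$ i.e. there are constants $c_1,c_2>0$ and $t_0\geq 1$ (depending on $n$) with $c_1t^2(\log t)^{n-1}\leq R_n^s(t)\leq c_2 t^2(\log t)^{n-1}$ for all $t\geq t_0$.
   Context: For a polynomial $p(X)=a_nX^n+\cdots+a_0\in\mathbb{Z}[X]$ its height is $H(p)=\max\{|a_i| : i=0,\dots,n\}$. For an integer $n\geq 1$ and real $t\geq 1$, $R_n^s(t)$ denotes the number of polynomials $p(X)\in\mathbb{Z}[X]$ of degree exactly $n$ with $H(p)\leq t$ which split completely into linear factors in $\mathbb{Q}[X]$ (equivalently in $\mathbb{Z}[X]$). *)

theory Defs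
  imports Complex_Main "HOL-Computational_Algebra.Polynomial"
begin

definition height :: "int poly \<Rightarrow> int" where
  "height p = Max {\<bar>coeff p i\<bar> | i. i \<le> degree p}"

definition splits_completely :: "'a::field poly \<Rightarrow> bool" where
  "splits_completely p \<longleftrightarrow>
     (\<exists>c qs. c \<noteq> 0 \<and> (\<forall>q\<in>set qs. degree q = 1) \<and> p = smult c (prod_list qs))"

definition split_polys :: "nat \<Rightarrow> real \<Rightarrow> int poly set" where
  "split_polys n t =
     {p. degree p = n \<and> of_int (height p) \<le> t \<and>
         splits_completely (map_poly rat_of_int p)}"

definition R_split :: "nat \<Rightarrow> real \<Rightarrow> nat" where
  "R_split n t = card (split_polys n t)"

text \<open>The count is a genuine one: the cardinality is never that of an infinite set.\<close>

lemma abs_coeff_le_height: "\<bar>coeff p i\<bar> \<le> height p"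
proof -
  have fin: "finite {\<bar>coeff p i\<bar> | i. i \<le> degree p}"
    by simp
  have le: "\<bar>coeff p j\<bar> \<le> height p" if "j \<le> degree p" for j
    unfolding height_def using fin that by (intro Max_ge) auto
  show ?thesis
  proof (cases "i \<le> degree p")
    case False
    then have "coeff p i = 0"
      by (simp add: coeff_eq_0)
    then show ?thesis
      using le[of 0] by simp
  qed (rule le)
qed

lemma finite_split_polys: "finite (split_polys n t)"
proof (rule finite_subset)
  let ?L = "{xs. set xs \<subseteq> {- \<lfloor>t\<rfloor>..\<lfloor>t\<rfloor>} \<and> length xs \<le> Suc n}"
  show "finite (Poly ` ?L)"
    by (intro finite_imageI finite_lists_length_le) simp
  show "split_polys n t \<subseteq> Poly ` ?L"
  proof
    fix p assume p: "p \<in> split_polys n t"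
    have "height p \<le> \<lfloor>t\<rfloor>"
      using p by (simp add: split_polys_def le_floor_iff)
    then have *: "\<bar>coeff p i\<bar> \<le> \<lfloor>t\<rfloor>" for i
      using abs_coeff_le_height[of p i] by linarith
    have "x \<in> {- \<lfloor>t\<rfloor>..\<lfloor>t\<rfloor>}" if "x \<in> set (coeffs p)" for x
    proof -
      obtain i where i: "i < length (coeffs p)" "x = coeffs p ! i"
        using \<open>x \<in> set (coeffs p)\<close> unfolding in_set_conv_nth by blast
      have "x = coeff p i"
        using i nth_default_nth[of i "coeffs p" 0] by (simp add: nth_default_coeffs_eq)
      then show ?thesis
        using *[of i] by auto
    qed
    moreover have "length (coeffs p) \<le> Suc n"
      using p by (simp add: coeffs_def split_polys_def)
    ultimately have "coeffs p \<in> ?L"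
      by blast
    then have "Poly (coeffs p) \<in> Poly ` ?L"
      by (rule imageI)
    then show "p \<in> Poly ` ?L"
      by simp
  qed
qed

end

theory Submission imports Defs "HOL-Computational_Algebra.Polynomial_Factorial" begin

text \<open>By Gauss' lemma a polynomial counted by \<open>R_split n t\<close> is a product of \<open>n\<close> integral linear
  polynomials \<open>a X + b\<close>, and its height agrees, up to constants depending on \<open>n\<close>, with the product
  of the heights of the factors. There are \<open>O(h)\<close> linear polynomials of height \<open>h\<close>, so the upper
  bound is \<open>\<Sum> h\<^sub>1 \<cdots> h\<^sub>n\<close> over \<open>h\<^sub>1 \<cdots> h\<^sub>n \<le> T\<close>, which is at most
  \<open>T\<^sup>2\<close> times the \<open>(n - 1)\<close>-st power of a harmonic sum.
  For the lower bound, at least half of the pairs in \<open>[1, y]\<^sup>2\<close> are coprime, hence at least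
  \<open>4\<^sup>j\<close> primitive linear polynomials have height in \<open>(2\<^sup>j, 2\<^sup>j\<^sup>+\<^sup>1]\<close>. Distributing a total
  exponent \<open>J\<close> over \<open>n\<close> factors gives at least \<open>4\<^sup>J\<close> times a binomial coefficient of order
  \<open>J\<^sup>n\<^sup>-\<^sup>1\<close> many tuples, and a product arises from at most \<open>n\<^sup>n\<close> tuples because each
  primitive factor is determined by its root.\<close>

section \<open>Heights of products of linear polynomials\<close>

definition lin :: "int \<times> int \<Rightarrow> int poly" where
  "lin x = [:snd x, fst x:]"

definition lin_prod :: "(int \<times> int) list \<Rightarrow> int poly" where
  "lin_prod xs = prod_list (map lin xs)"

definition ht :: "int \<times> int \<Rightarrow> nat" where
  "ht x = nat (max \<bar>fst x\<bar> \<bar>snd x\<bar>)"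

definition hts :: "(int \<times> int) list \<Rightarrow> nat" where
  "hts xs = prod_list (map ht xs)"

lemma lin_prod_simps [simp]:
  "lin_prod [] = 1" "lin_prod (x # xs) = lin x * lin_prod xs"
  by (simp_all add: lin_prod_def)

lemma hts_simps [simp]:
  "hts [] = 1" "hts (x # xs) = ht x * hts xs"
  by (simp_all add: hts_def)

text \<open>Coefficients beyond the degree vanish, so the index may range over all naturals; later
  height estimates then need no degree bookkeeping.\<close>

lemma height_le_iff: "height p \<le> M \<longleftrightarrow> (\<forall>i. \<bar>coeff p i\<bar> \<le> M)"
proof
  assume "height p \<le> M"
  then show "\<forall>i. \<bar>coeff p i\<bar> \<le> M"
    using abs_coeff_le_height order_trans by blast
next
  assume "\<forall>i. \<bar>coeff p i\<bar> \<le> M"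
  moreover have "{\<bar>coeff p i\<bar> | i. i \<le> degree p} \<noteq> {}"
    by auto
  ultimately show "height p \<le> M"
    unfolding height_def by (subst Max_le_iff) auto
qed

lemma height_nonneg: "0 \<le> height p"
  using abs_coeff_le_height[of p 0] by linarith

lemma height_1: "height 1 = 1"
proof (rule antisym)
  show "height 1 \<le> 1"
    by (simp add: height_le_iff coeff_pCons one_pCons split: nat.split)
  show "1 \<le> height 1"
    using abs_coeff_le_height[of 1 0] by simp
qed

lemma coeff_lin_mult_0: "coeff (lin x * q) 0 = snd x * coeff q 0"
  by (simp add: lin_def coeff_mult)

lemma coeff_lin_mult_Suc: "coeff (lin x * q) (Suc i) = snd x * coeff q (Suc i) + fst x * coeff q i"
  by (simp add: lin_def mult_pCons_left)

lemma ht_bounds: "\<bar>fst x\<bar> \<le> int (ht x)" "\<bar>snd x\<bar> \<le> int (ht x)"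
  by (simp_all add: ht_def max_def)

text \<open>Each coefficient of the product is a sum of at most two terms, each an entry of
  \<open>x\<close> times a coefficient of \<open>q\<close>; hence the factor 2.\<close>

lemma height_lin_mult_le: "height (lin x * q) \<le> 2 * int (ht x) * height q"
proof -
  have le: "\<bar>c * coeff q i\<bar> \<le> int (ht x) * height q" if "\<bar>c\<bar> \<le> int (ht x)" for c i
    unfolding abs_mult using that abs_coeff_le_height by (intro mult_mono) auto
  have "\<bar>coeff (lin x * q) i\<bar> \<le> 2 * int (ht x) * height q" for i
  proof (cases i)
    case 0
    then show ?thesis
      using le[OF ht_bounds(2), of 0] height_nonneg[of q]
      by (simp add: coeff_lin_mult_0)
  next
    case (Suc j)
    then show ?thesis
      using le[OF ht_bounds(2), of i] le[OF ht_bounds(1), of j]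
      by (simp add: coeff_lin_mult_Suc)
  qed
  then show ?thesis
    by (simp add: height_le_iff)
qed

lemma height_lin_prod_le: "height (lin_prod xs) \<le> 2 ^ length xs * int (hts xs)"
proof (induction xs)
  case (Cons x xs)
  have "height (lin_prod (x # xs)) \<le> 2 * int (ht x) * height (lin_prod xs)"
    by (simp add: height_lin_mult_le)
  also have "\<dots> \<le> 2 * int (ht x) * (2 ^ length xs * int (hts xs))"
    using Cons.IH by (intro mult_left_mono) auto
  finally show ?case
    by (simp add: algebra_simps)
qed (simp add: height_1)

text \<open>If \<open>\<bar>a\<bar> \<ge> \<bar>b\<bar>\<close>, the relation \<open>a q\<^sub>i = f\<^sub>i\<^sub>+\<^sub>1 - b q\<^sub>i\<^sub>+\<^sub>1\<close> for \<open>f = (a X + b) q\<close> bounds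
  the coefficients of \<open>q\<close> from the top one downwards; otherwise one starts from the constant one.\<close>

lemma ht_mult_height_le:
  "int (ht x) * height q \<le> int (Suc (degree q)) * height (lin x * q)"
proof -
  define F where "F = height (lin x * q)"
  define d where "d = degree q"
  have F: "\<bar>coeff (lin x * q) i\<bar> \<le> F" for i
    unfolding F_def by (rule abs_coeff_le_height)
  have F0: "0 \<le> F"
    unfolding F_def by (rule height_nonneg)
  have bound: "int (ht x) * \<bar>coeff q i\<bar> \<le> int (Suc d) * F" for i
  proof (cases "\<bar>snd x\<bar> \<le> \<bar>fst x\<bar>")
    case True
    then have h: "int (ht x) = \<bar>fst x\<bar>"
      by (simp add: ht_def)
    \<comment> \<open>Here \<open>j\<close> counts downwards from index \<open>d + 1\<close>, where
      the coefficient of \<open>q\<close> is 0, so that \<open>j = 0\<close> is a trivial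
      start.\<close>
    have down: "\<bar>fst x\<bar> * \<bar>coeff q (Suc d - j)\<bar> \<le> int j * F" if "j \<le> Suc d" for j
      using that
    proof (induction j)
      case 0
      then show ?case by (simp add: d_def coeff_eq_0)
    next
      case (Suc j)
      define k where "k = Suc d - Suc j"
      have k: "Suc k = Suc d - j"
        using Suc.prems by (simp add: k_def)
      have "\<bar>fst x * coeff q k\<bar> = \<bar>coeff (lin x * q) (Suc k) - snd x * coeff q (Suc k)\<bar>"
        by (simp add: coeff_lin_mult_Suc)
      also have "\<dots> \<le> F + \<bar>snd x\<bar> * \<bar>coeff q (Suc k)\<bar>"
        using F[of "Suc k"] abs_triangle_ineq4[of "coeff (lin x * q) (Suc k)" "snd x * coeff q (Suc k)"]
        by (simp add: abs_mult)
      also have "\<dots> \<le> F + \<bar>fst x\<bar> * \<bar>coeff q (Suc k)\<bar>"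
        using True by (intro add_left_mono mult_right_mono) auto
      also have "\<dots> \<le> F + int j * F"
        using Suc k by simp
      finally show ?case
        unfolding k_def[symmetric] by (simp add: abs_mult algebra_simps)
    qed
    show ?thesis
    proof (cases "i \<le> d")
      case True
      have "\<bar>fst x\<bar> * \<bar>coeff q i\<bar> \<le> int (Suc d - i) * F"
        using down[of "Suc d - i"] True by simp
      also have "\<dots> \<le> int (Suc d) * F"
        using F0 by (intro mult_right_mono) auto
      finally show ?thesis
        by (simp add: h)
    qed (simp add: d_def coeff_eq_0 F0)
  next
    case False
    then have h: "int (ht x) = \<bar>snd x\<bar>"
      by (simp add: ht_def)
    have up: "\<bar>snd x\<bar> * \<bar>coeff q i\<bar> \<le> int (Suc i) * F" for i
    proof (induction i)
      case 0
      then show ?case using F[of 0] by (simp add: coeff_lin_mult_0 abs_mult)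
    next
      case (Suc i)
      have "\<bar>snd x * coeff q (Suc i)\<bar> = \<bar>coeff (lin x * q) (Suc i) - fst x * coeff q i\<bar>"
        by (simp add: coeff_lin_mult_Suc)
      also have "\<dots> \<le> F + \<bar>fst x\<bar> * \<bar>coeff q i\<bar>"
        using F[of "Suc i"] abs_triangle_ineq4[of "coeff (lin x * q) (Suc i)" "fst x * coeff q i"]
        by (simp add: abs_mult)
      also have "\<dots> \<le> F + \<bar>snd x\<bar> * \<bar>coeff q i\<bar>"
        using False by (intro add_left_mono mult_right_mono) auto
      also have "\<dots> \<le> F + int (Suc i) * F"
        using Suc by simp
      finally show ?case
        by (simp add: abs_mult algebra_simps)
    qed
    show ?thesis
    proof (cases "i \<le> d")
      case True
      then have "int (Suc i) * F \<le> int (Suc d) * F"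
        using F0 by (intro mult_right_mono) auto
      with up[of i] show ?thesis
        by (simp add: h)
    qed (simp add: d_def coeff_eq_0 F0)
  qed
  show ?thesis
  proof (cases "ht x = 0")
    case False
    \<comment> \<open>Dividing first gives one integer bound for all coefficients, as
      \<open>height_le_iff\<close> requires; multiplying back by \<open>ht x\<close> loses only the
      remainder.\<close>
    have "height q \<le> (int (Suc d) * F) div int (ht x)"
      unfolding height_le_iff
    proof
      fix i
      show "\<bar>coeff q i\<bar> \<le> (int (Suc d) * F) div int (ht x)"
        using zdiv_mono1[OF bound, of "int (ht x)" i] False by simp
    qed
    then have "int (ht x) * height q \<le> int (ht x) * ((int (Suc d) * F) div int (ht x))"
      by (intro mult_left_mono) auto
    also have "\<dots> \<le> int (Suc d) * F"
      using False mult_div_mod_eq[of "int (ht x)" "int (Suc d) * F"]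
        pos_mod_sign[of "int (ht x)" "int (Suc d) * F"] by linarith
    finally show ?thesis
      by (simp add: F_def d_def)
  qed (simp add: height_nonneg)
qed

lemma lin_prod_degree:
  assumes "\<forall>x\<in>set xs. fst x \<noteq> 0"
  shows "lin_prod xs \<noteq> 0 \<and> degree (lin_prod xs) = length xs"
  using assms
proof (induction xs)
  case (Cons x xs)
  then have "lin x \<noteq> 0" "degree (lin x) = 1" and "lin_prod xs \<noteq> 0 \<and> degree (lin_prod xs) = length xs"
    by (auto simp: lin_def)
  then show ?case
    by (simp add: degree_mult_eq)
qed simp

text \<open>Splitting off one factor costs the degree of the remaining product plus one; these
  losses multiply up to the factorial.\<close>

lemma hts_le_height_lin_prod:
  assumes "\<forall>x\<in>set xs. fst x \<noteq> 0"
  shows "int (hts xs) \<le> fact (length xs) * height (lin_prod xs)"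
  using assms
proof (induction xs)
  case (Cons x xs)
  let ?n = "length xs"
  have "int (hts (x # xs)) = int (ht x) * int (hts xs)"
    by simp
  also have "\<dots> \<le> int (ht x) * (fact ?n * height (lin_prod xs))"
    using Cons by (intro mult_left_mono) auto
  also have "\<dots> = fact ?n * (int (ht x) * height (lin_prod xs))"
    by simp
  also have "\<dots> \<le> fact ?n * (int (Suc ?n) * height (lin x * lin_prod xs))"
    using ht_mult_height_le[of x "lin_prod xs"] lin_prod_degree[of xs] Cons.prems
    by (intro mult_left_mono) auto
  finally show ?case
    by (simp add: algebra_simps)
qed (simp add: height_1)

section \<open>Factorisation over the rationals and over the integers\<close>

abbreviation rpoly :: "int poly \<Rightarrow> rat poly" where
  "rpoly \<equiv> map_poly rat_of_int"

lemma rpoly_mult: "rpoly (p * q) = rpoly p * rpoly q"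
  by (rule poly_eqI) (simp add: coeff_map_poly coeff_mult)

lemma rpoly_smult: "rpoly (smult c p) = smult (of_int c) (rpoly p)"
  by (rule poly_eqI) (simp add: coeff_map_poly)

lemma rpoly_eq_iff: "rpoly p = rpoly q \<longleftrightarrow> p = q"
  by (simp add: poly_eq_iff coeff_map_poly)

lemma degree_1_conv_lin:
  assumes "degree p = 1"
  shows "p = lin (coeff p 1, coeff p 0)" "coeff p 1 \<noteq> 0"
proof -
  show "p = lin (coeff p 1, coeff p 0)"
    by (rule poly_eqI)
      (use assms in \<open>auto simp: lin_def coeff_pCons coeff_eq_0 split: nat.split\<close>)
  show "coeff p 1 \<noteq> 0"
    using assms leading_coeff_0_iff[of p] by auto
qed

text \<open>Clear denominators, then divide by the content; both scalars go into
  \<open>c\<close>.\<close>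

lemma rat_linear_conv_primitive:
  fixes q :: "rat poly"
  assumes "degree q = 1"
  obtains c x where "c \<noteq> 0" "fst x \<noteq> 0" "content (lin x) = 1" "q = smult c (rpoly (lin x))"
proof -
  obtain a b where ab: "quotient_of (coeff q 1) = (a, b)"
    by fastforce
  obtain a' b' where ab': "quotient_of (coeff q 0) = (a', b')"
    by fastforce
  have b: "b > 0" "b' > 0"
    using ab ab' quotient_of_denom_pos by auto
  have q: "coeff q 1 = of_int a / of_int b" "coeff q 0 = of_int a' / of_int b'"
    using ab ab' quotient_of_div by auto
  define p where "p = [:a' * b, a * b':]"
  have "a \<noteq> 0"
    using q assms leading_coeff_0_iff[of q] by auto
  then have degp: "degree p = 1"
    using b by (simp add: p_def)
  have pq: "rpoly p = smult (of_int (b * b')) q"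
    by (rule poly_eqI) (use b assms q in \<open>auto simp: p_def coeff_map_poly coeff_pCons coeff_eq_0 split: nat.split\<close>)
  define r where "r = primitive_part p"
  define x where "x = (coeff r 1, coeff r 0)"
  have degr: "degree r = 1"
    using degp by (simp add: r_def)
  then have r: "r = lin x" "fst x \<noteq> 0"
    using degree_1_conv_lin[of r] by (auto simp: x_def)
  have "p \<noteq> 0"
    using degp by auto
  then have c: "content r = 1" "content p \<noteq> 0"
    by (simp_all add: r_def)
  have "smult (of_int (content p)) (rpoly r) = smult (of_int (b * b')) q"
    unfolding pq[symmetric] rpoly_smult[symmetric] r_def by simp
  then have "q = smult (of_int (content p) / of_int (b * b')) (rpoly (lin x))"
    using b r by (smt (verit) smult_smult divide_inverse mult.commute of_int_0_eq_iff left_inverse mult_eq_0_iff smult_1_left)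
  then show ?thesis
    using that[of "of_int (content p) / of_int (b * b')" x] r c b by simp
qed

text \<open>This is where Gauss' lemma enters: by \<open>content_mult\<close>, a product of
  primitive factors is primitive.\<close>

lemma rat_linear_prod_conv_primitive:
  fixes qs :: "rat poly list"
  assumes "\<forall>q\<in>set qs. degree q = 1"
  shows "\<exists>c xs. c \<noteq> 0 \<and> length xs = length qs \<and> (\<forall>x\<in>set xs. fst x \<noteq> 0) \<and>
           content (lin_prod xs) = 1 \<and> prod_list qs = smult c (rpoly (lin_prod xs))"
  using assms
proof (induction qs)
  case Nil
  show ?case
    by (rule exI[of _ 1], rule exI[of _ "[]"]) simp
next
  case (Cons q qs)
  then obtain c xs where IH: "c \<noteq> 0" "length xs = length qs" "\<forall>x\<in>set xs. fst x \<noteq> 0"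
    "content (lin_prod xs) = 1" "prod_list qs = smult c (rpoly (lin_prod xs))"
    by auto
  obtain d x where x: "d \<noteq> 0" "fst x \<noteq> 0" "content (lin x) = 1" "q = smult d (rpoly (lin x))"
    using Cons.prems by (auto intro: rat_linear_conv_primitive)
  show ?case
    by (rule exI[of _ "c * d"], rule exI[of _ "x # xs"])
      (use IH x in \<open>auto simp: content_mult rpoly_mult ac_simps\<close>)
qed

text \<open>The rational constant in front of a primitive product must be an integer if the result
  is integral. It is absorbed into the first factor, which exists because
  \<open>n \<ge> 1\<close>.\<close>

lemma splits_completely_imp_lin_prod:
  assumes "splits_completely (rpoly p)" "degree p = n" "n \<ge> 1"
  obtains xs where "length xs = n" "\<forall>x\<in>set xs. fst x \<noteq> 0" "p = lin_prod xs"
proof -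
  obtain c0 qs where qs: "c0 \<noteq> 0" "\<forall>q\<in>set qs. degree q = 1" "rpoly p = smult c0 (prod_list qs)"
    using assms(1) unfolding splits_completely_def by auto
  obtain c1 xs where xs: "c1 \<noteq> 0" "\<forall>x\<in>set xs. fst x \<noteq> 0" "content (lin_prod xs) = 1"
    "prod_list qs = smult c1 (rpoly (lin_prod xs))"
    using rat_linear_prod_conv_primitive[OF qs(2)] by auto
  define c where "c = c0 * c1"
  have c: "c \<noteq> 0" "rpoly p = smult c (rpoly (lin_prod xs))"
    using qs xs by (simp_all add: c_def)
  obtain u v where uv: "quotient_of c = (u, v)"
    by fastforce
  have v: "v > 0" and cuv: "c = of_int u / of_int v"
    using uv quotient_of_denom_pos quotient_of_div by auto
  have "rpoly (smult v p) = rpoly (smult u (lin_prod xs))"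
    using c cuv v by (simp add: rpoly_smult)
  then have eq: "smult v p = smult u (lin_prod xs)"
    by (simp only: rpoly_eq_iff)
  \<comment> \<open>With \<open>lin_prod xs\<close> primitive, comparing contents shows that the
    denominator \<open>v\<close> of \<open>c\<close> divides its numerator \<open>u\<close>.\<close>
  then have "content (smult v p) = content (smult u (lin_prod xs))"
    by simp
  then have "v * content p = \<bar>u\<bar>"
    using v xs by simp
  then have "v dvd u"
    by (metis dvd_abs_iff dvd_triv_left)
  then obtain w where w: "u = v * w" by blast
  have p: "p = smult w (lin_prod xs)"
  proof -
    have "smult v p = smult v (smult w (lin_prod xs))"
      using eq w by simp
    then show ?thesis
      using v smult_cancel[of v p] by (metis less_irrefl smult_eq_iff smult_1_left)
  qed
  have "w \<noteq> 0"
    using assms p by auto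
  then have len: "length xs = n"
    using p assms(2) lin_prod_degree[OF xs(2)] by simp
  then obtain x ys where ys: "xs = x # ys"
    using assms(3) by (cases xs) auto
  have "smult w (lin x) = lin (w * fst x, w * snd x)"
    by (simp add: lin_def)
  then have "p = lin_prod ((w * fst x, w * snd x) # ys)"
    using p ys by (metis lin_prod_simps(2) mult_smult_left)
  then show ?thesis
    using that[of "(w * fst x, w * snd x) # ys"] len ys xs \<open>w \<noteq> 0\<close> by auto
qed

lemma splits_completely_lin_prod:
  assumes "\<forall>x\<in>set xs. fst x \<noteq> 0"
  shows "splits_completely (rpoly (lin_prod xs))"
proof -
  have "rpoly (lin_prod xs) = prod_list (map (rpoly \<circ> lin) xs)"
    by (induction xs) (simp_all add: rpoly_mult)
  moreover have "\<forall>q\<in>set (map (rpoly \<circ> lin) xs). degree q = 1"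
    using assms by (auto simp: lin_def map_poly_pCons)
  ultimately show ?thesis
    unfolding splits_completely_def by (metis smult_1_left zero_neq_one)
qed

section \<open>Counting lists of linear polynomials from above\<close>

text \<open>The bound \<open>T\<close> is real so that it can be divided by the height of a removed
  factor. Coprimality is not demanded, as overcounting is harmless for an upper bound.\<close>

definition lists_upto :: "nat \<Rightarrow> real \<Rightarrow> (int \<times> int) list set" where
  "lists_upto n T = {xs. length xs = n \<and> (\<forall>x\<in>set xs. fst x \<noteq> 0) \<and> real (hts xs) \<le> T}"

lemma ht_pos: "fst x \<noteq> 0 \<Longrightarrow> 0 < ht x"
  by (simp add: ht_def)

lemma hts_pos: "\<forall>x\<in>set xs. fst x \<noteq> 0 \<Longrightarrow> 0 < hts xs"
  by (induction xs) (simp_all add: ht_pos)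

text \<open>The points of height \<open>h\<close> form the boundary of a square, covered by two
  pairs of opposite sides with \<open>2 * (2 * h + 1) \<le> 6 * h\<close> points each.\<close>

lemma finite_card_ht_eq:
  assumes "h \<ge> 1"
  shows "finite {x. ht x = h}" "card {x. ht x = h} \<le> 12 * h"
proof -
  define A where "A = {int h, - int h} \<times> {- int h..int h}"
  define B where "B = {- int h..int h} \<times> {int h, - int h}"
  have sub: "{x. ht x = h} \<subseteq> A \<union> B"
    by (auto simp: ht_def A_def B_def max_def split: if_splits)
  have fin: "finite (A \<union> B)"
    by (simp add: A_def B_def)
  then show "finite {x. ht x = h}"
    using sub finite_subset by blast
  have "card {int h, - int h} = 2"
    using assms by (simp add: card_insert_if)
  moreover have "card {- int h..int h} = 2 * h + 1"
    by simp
  ultimately have "card A \<le> 6 * h" "card B \<le> 6 * h"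
    using assms unfolding A_def B_def card_cartesian_product by simp_all
  then show "card {x. ht x = h} \<le> 12 * h"
    using card_mono[OF fin sub] card_Un_le[of A B] by linarith
qed

text \<open>The list is split by the height \<open>h\<close> of its head; the other heights are
  positive integers, so \<open>h \<le> T\<close>.\<close>

lemma lists_upto_Suc_subset:
  "lists_upto (Suc n) T \<subseteq>
     (\<Union>h\<in>{1..nat \<lfloor>T\<rfloor>}. (\<lambda>(x, xs). x # xs) ` ({x. ht x = h} \<times> lists_upto n (T / real h)))"
proof
  fix zs assume "zs \<in> lists_upto (Suc n) T"
  then obtain x xs where zs: "zs = x # xs" "length xs = n" "fst x \<noteq> 0" "\<forall>x\<in>set xs. fst x \<noteq> 0"
    "real (ht x * hts xs) \<le> T"
    unfolding lists_upto_def by (cases zs) auto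
  have pos: "ht x > 0" "hts xs > 0"
    using zs ht_pos hts_pos by auto
  then have "ht x * 1 \<le> ht x * hts xs"
    by (intro mult_left_mono) auto
  then have "real (ht x) \<le> real (ht x * hts xs)"
    by (metis mult.right_neutral of_nat_le_iff)
  then have "real (ht x) \<le> T"
    using zs(5) by linarith
  then have "ht x \<in> {1..nat \<lfloor>T\<rfloor>}"
    using pos by (auto simp: le_nat_floor)
  moreover have "xs \<in> lists_upto n (T / real (ht x))"
    using zs pos by (simp add: lists_upto_def field_simps)
  ultimately show "zs \<in> (\<Union>h\<in>{1..nat \<lfloor>T\<rfloor>}. (\<lambda>(x, xs). x # xs) ` ({x. ht x = h} \<times> lists_upto n (T / real h)))"
    using zs(1) by force
qed

lemma finite_lists_upto: "finite (lists_upto n T)"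
proof (induction n arbitrary: T)
  case 0
  have "lists_upto 0 T \<subseteq> {[]}"
    by (auto simp: lists_upto_def)
  then show ?case
    by (rule finite_subset) simp
next
  case (Suc n)
  show ?case
    by (rule finite_subset[OF lists_upto_Suc_subset])
      (use Suc finite_card_ht_eq(1) in auto)
qed

lemma card_lists_upto_Suc_le:
  "real (card (lists_upto (Suc n) T))
     \<le> (\<Sum>h = 1..nat \<lfloor>T\<rfloor>. 12 * real h * real (card (lists_upto n (T / real h))))"
proof -
  let ?f = "\<lambda>(x, xs). x # xs"
  let ?A = "\<lambda>h. {x. ht x = h} \<times> lists_upto n (T / real h)"
  have fin: "finite (?f ` ?A h)" if "h \<in> {1..nat \<lfloor>T\<rfloor>}" for h
    using that finite_card_ht_eq(1)[of h] finite_lists_upto by simp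
  have le: "card (?f ` ?A h) \<le> 12 * h * card (lists_upto n (T / real h))" if "h \<in> {1..nat \<lfloor>T\<rfloor>}" for h
  proof -
    have "card (?f ` ?A h) \<le> card (?A h)"
      using that finite_card_ht_eq(1)[of h] finite_lists_upto by (intro card_image_le) simp
    also have "\<dots> \<le> 12 * h * card (lists_upto n (T / real h))"
      unfolding card_cartesian_product using that finite_card_ht_eq(2)[of h] by (intro mult_right_mono) auto
    finally show ?thesis .
  qed
  have "card (lists_upto (Suc n) T) \<le> card (\<Union>h\<in>{1..nat \<lfloor>T\<rfloor>}. ?f ` ?A h)"
    using fin by (intro card_mono lists_upto_Suc_subset) blast
  also have "\<dots> \<le> (\<Sum>h = 1..nat \<lfloor>T\<rfloor>. card (?f ` ?A h))"
    by (rule card_UN_le) simp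
  also have "\<dots> \<le> (\<Sum>h = 1..nat \<lfloor>T\<rfloor>. 12 * h * card (lists_upto n (T / real h)))"
    by (rule sum_mono) (rule le)
  finally have "real (card (lists_upto (Suc n) T)) \<le> real (\<Sum>h = 1..nat \<lfloor>T\<rfloor>. 12 * h * card (lists_upto n (T / real h)))"
    by (simp only: of_nat_le_iff)
  then show ?thesis
    by simp
qed

text \<open>The induction step is \<open>ln x \<le> x - 1\<close> at
  \<open>x = m / (m + 1)\<close>.\<close>

lemma sum_inverse_le_ln:
  assumes "m \<ge> 1"
  shows "(\<Sum>h = 1..m. 1 / real h) \<le> 1 + ln (real m)"
  using assms
proof (induction m rule: dec_induct)
  case (step m)
  have "ln (real m / real (Suc m)) \<le> real m / real (Suc m) - 1"
    using step by (intro ln_le_minus_one) auto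
  moreover have "ln (real m / real (Suc m)) = ln (real m) - ln (real (Suc m))"
    using step by (simp add: ln_div)
  moreover have "real m / real (Suc m) - 1 = - (1 / real (Suc m))"
    by (simp add: field_simps)
  ultimately show ?case
    using step by simp
qed simp

text \<open>The first factor contributes at most \<open>T\<close> terms of size
  \<open>12 * T\<close> and no logarithm. For each further one, the weight \<open>h\<close> times
  \<open>(T / h)\<^sup>2\<close> is \<open>T\<^sup>2 / h\<close>, so the sum over \<open>h\<close>
  costs one factor \<open>1 + ln T\<close>.\<close>

lemma card_lists_upto_le:
  assumes "T \<ge> 1"
  shows "real (card (lists_upto (Suc n) T)) \<le> 12 ^ Suc n * T\<^sup>2 * (1 + ln T) ^ n"
  using assms
proof (induction n arbitrary: T)
  case 0
  have m: "real (nat \<lfloor>T\<rfloor>) \<le> T"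
    using 0 by simp
  have c1: "card (lists_upto 0 S) \<le> 1" for S
    using card_mono[of "{[]}" "lists_upto 0 S"] by (auto simp: lists_upto_def)
  have "real (card (lists_upto (Suc 0) T))
      \<le> (\<Sum>h = 1..nat \<lfloor>T\<rfloor>. 12 * real h * real (card (lists_upto 0 (T / real h))))"
    by (rule card_lists_upto_Suc_le)
  also have "\<dots> \<le> (\<Sum>h = 1..nat \<lfloor>T\<rfloor>. 12 * T)"
  proof (rule sum_mono)
    fix h assume "h \<in> {1..nat \<lfloor>T\<rfloor>}"
    then have "real h \<le> real (nat \<lfloor>T\<rfloor>)"
      by simp
    then have "real h \<le> T"
      using m by linarith
    then show "12 * real h * real (card (lists_upto 0 (T / real h))) \<le> 12 * T"
      using mult_mono[of "12 * real h" "12 * T" "real (card (lists_upto 0 (T / real h)))" 1] c1 0 by simp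
  qed
  also have "\<dots> = real (nat \<lfloor>T\<rfloor>) * (12 * T)"
    by simp
  also have "\<dots> \<le> T * (12 * T)"
    using m 0 by (intro mult_right_mono) auto
  finally show ?case
    by (simp add: power2_eq_square)
next
  case (Suc n)
  define m where "m = nat \<lfloor>T\<rfloor>"
  have m: "real m \<le> T" "m \<ge> 1"
    using Suc.prems by (auto simp: m_def le_nat_floor)
  define C where "C = 12 ^ Suc (Suc n) * T\<^sup>2 * (1 + ln T) ^ n"
  have C: "C \<ge> 0"
    using Suc.prems by (simp add: C_def)
  have "real (card (lists_upto (Suc (Suc n)) T))
      \<le> (\<Sum>h = 1..m. 12 * real h * real (card (lists_upto (Suc n) (T / real h))))"
    unfolding m_def by (rule card_lists_upto_Suc_le)
  also have "\<dots> \<le> (\<Sum>h = 1..m. C * (1 / real h))"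
  proof (rule sum_mono)
    fix h assume h: "h \<in> {1..m}"
    then have hT: "real h \<le> T" "real h \<ge> 1"
      using m(1) by auto
    have "ln (T / real h) \<le> ln T"
      using hT Suc.prems by (simp add: ln_div)
    moreover have T1: "1 \<le> T / real h"
      using hT by simp
    ultimately have "(1 + ln (T / real h)) ^ n \<le> (1 + ln T) ^ n"
      using ln_ge_zero[OF T1] by (intro power_mono) auto
    then have "12 ^ Suc n * (T / real h)\<^sup>2 * (1 + ln (T / real h)) ^ n
        \<le> 12 ^ Suc n * (T / real h)\<^sup>2 * (1 + ln T) ^ n"
      by (intro mult_left_mono) auto
    then have "real (card (lists_upto (Suc n) (T / real h))) \<le> 12 ^ Suc n * (T / real h)\<^sup>2 * (1 + ln T) ^ n"
      using Suc.IH[OF T1] by linarith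
    then have "12 * real h * real (card (lists_upto (Suc n) (T / real h)))
        \<le> 12 * real h * (12 ^ Suc n * (T / real h)\<^sup>2 * (1 + ln T) ^ n)"
      using hT by (intro mult_left_mono) auto
    also have "\<dots> = C * (1 / real h)"
      using hT by (simp add: C_def field_simps power2_eq_square)
    finally show "12 * real h * real (card (lists_upto (Suc n) (T / real h))) \<le> C * (1 / real h)" .
  qed
  also have "\<dots> = C * (\<Sum>h = 1..m. 1 / real h)"
    by (simp only: sum_distrib_left)
  also have "\<dots> \<le> C * (1 + ln T)"
  proof (intro mult_left_mono C)
    have "ln (real m) \<le> ln T"
      using m by simp
    then show "(\<Sum>h = 1..m. 1 / real h) \<le> 1 + ln T"
      using sum_inverse_le_ln[OF m(2)] by linarith
  qed
  finally show ?case
    by (simp add: C_def algebra_simps)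
qed

section \<open>Upper bound for the number of split polynomials\<close>

lemma split_polys_subset: "n \<ge> 1 \<Longrightarrow> split_polys n t \<subseteq> lin_prod ` lists_upto n (fact n * t)"
proof
  fix p assume n: "n \<ge> 1" and "p \<in> split_polys n t"
  then have p: "degree p = n" "of_int (height p) \<le> t" "splits_completely (rpoly p)"
    by (simp_all add: split_polys_def)
  obtain xs where xs: "length xs = n" "\<forall>x\<in>set xs. fst x \<noteq> 0" "p = lin_prod xs"
    using splits_completely_imp_lin_prod[OF p(3) p(1) n] by blast
  have "int (hts xs) \<le> fact n * height p"
    using hts_le_height_lin_prod[OF xs(2)] xs by simp
  then have "real_of_int (int (hts xs)) \<le> real_of_int (fact n * height p)"
    by (simp only: of_int_le_iff)
  then have "real (hts xs) \<le> fact n * real_of_int (height p)"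
    by simp
  also have "\<dots> \<le> fact n * t"
    using p by (intro mult_left_mono) auto
  finally show "p \<in> lin_prod ` lists_upto n (fact n * t)"
    using xs by (auto simp: lists_upto_def)
qed

text \<open>The hypothesis on \<open>ln t\<close> says exactly that
  \<open>1 + ln (fact n * t) \<le> 2 * ln t\<close>, whence the factor
  \<open>2 ^ (n - 1)\<close>.\<close>

lemma R_split_upper:
  assumes "n \<ge> 1" "t \<ge> 1" "ln t \<ge> 1 + ln (fact n)"
  shows "real (R_split n t) \<le> 12 ^ n * (fact n)\<^sup>2 * 2 ^ (n - 1) * t\<^sup>2 * ln t ^ (n - 1)"
proof -
  define T where "T = fact n * t"
  obtain k where k: "n = Suc k"
    using assms(1) by (cases n) auto
  have f: "(1::real) \<le> fact n"
    by (rule fact_ge_1)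
  then have T: "T \<ge> 1"
    using mult_mono[of 1 "fact n" 1 t] assms by (simp add: T_def)
  have lnT: "ln T = ln (fact n) + ln t"
    using assms f unfolding T_def by (intro ln_mult_pos) auto
  have "R_split n t \<le> card (lin_prod ` lists_upto n T)"
    unfolding R_split_def T_def
    using assms by (intro card_mono split_polys_subset finite_imageI finite_lists_upto)
  also have "\<dots> \<le> card (lists_upto n T)"
    by (intro card_image_le finite_lists_upto)
  finally have "real (R_split n t) \<le> real (card (lists_upto n T))"
    by simp
  also have "\<dots> \<le> 12 ^ n * T\<^sup>2 * (1 + ln T) ^ (n - 1)"
    using card_lists_upto_le[OF T, of k] by (simp add: k)
  also have "\<dots> \<le> 12 ^ n * T\<^sup>2 * (2 * ln t) ^ (n - 1)"
    using T lnT assms by (intro mult_left_mono power_mono) auto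
  finally show ?thesis
    by (simp add: T_def power_mult_distrib algebra_simps)
qed

section \<open>Counting lists of primitive linear polynomials from below\<close>

text \<open>Positivity of both entries removes the sign ambiguity, so that a pair is determined by
  the root of its linear polynomial; the restriction costs only a constant.\<close>

definition prim :: "(int \<times> int) set" where
  "prim = {x. fst x > 0 \<and> snd x > 0 \<and> coprime (fst x) (snd x)}"

definition prim_box :: "nat \<Rightarrow> (int \<times> int) set" where
  "prim_box y = {x \<in> prim. ht x \<le> y}"

lemma prim_box_subset: "prim_box y \<subseteq> {1..int y} \<times> {1..int y}"
  by (auto simp: prim_box_def prim_def ht_def)

lemma finite_prim_box: "finite (prim_box y)"
  by (rule finite_subset[OF prim_box_subset]) simp

lemma card_prim_box_le: "card (prim_box y) \<le> y\<^sup>2"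
  using card_mono[OF _ prim_box_subset[of y]] by (simp add: card_cartesian_product power2_eq_square)

section \<open>Density of coprime pairs\<close>

lemma card_multiples_le:
  assumes "d \<ge> 1"
  shows "real (card {a \<in> {1..int y}. int d dvd a}) \<le> real y / real d"
proof -
  have "{a \<in> {1..int y}. int d dvd a} \<subseteq> (\<lambda>k. int d * int k) ` {1..y div d}"
  proof
    fix a assume "a \<in> {a \<in> {1..int y}. int d dvd a}"
    then obtain k where k: "a = int d * k" "1 \<le> a" "a \<le> int y"
      by auto
    then have "k > 0"
      using assms by (smt (verit) mult_nonneg_nonpos of_nat_0_le_iff)
    moreover have "d * nat k \<le> y"
      using k \<open>k > 0\<close> by (subst of_nat_le_iff[symmetric, where 'a = int]) simp
    then have "nat k \<le> y div d"
      using assms by (simp add: less_eq_div_iff_mult_less_eq mult.commute)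
    ultimately show "a \<in> (\<lambda>k. int d * int k) ` {1..y div d}"
      using k by (intro image_eqI[of _ _ "nat k"]) auto
  qed
  then have "card {a \<in> {1..int y}. int d dvd a} \<le> card ((\<lambda>k. int d * int k) ` {1..y div d})"
    by (intro card_mono) auto
  also have "\<dots> \<le> card {1..y div d}"
    by (rule card_image_le) simp
  finally have "real (card {a \<in> {1..int y}. int d dvd a}) \<le> real (y div d)"
    by simp
  also have "\<dots> \<le> real y / real d"
    by (rule of_nat_div_le_of_nat)
  finally show ?thesis .
qed

text \<open>Since \<open>(2 * k + 1)\<^sup>2 \<ge> 4 * k * (k + 1)\<close>, the sum is dominated by
  a telescoping one; the induction carries the remaining tail
  \<open>1 / (4 * (m + 1))\<close>.\<close>

lemma sum_inverse_odd_squares_le: "(\<Sum>k = 1..m. 1 / (real (2 * k + 1))\<^sup>2) \<le> 1 / 4"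
proof -
  have split: "1 / (4 * a * (a + 1)) = 1 / (4 * a) - 1 / (4 * (a + 1))" if "a > 0" for a :: real
    using that by (simp add: field_simps)
  have "(\<Sum>k = 1..m. 1 / (real (2 * k + 1))\<^sup>2) \<le> 1 / 4 - 1 / (4 * real (Suc m))"
  proof (induction m)
    case (Suc m)
    have "1 / (real (2 * Suc m + 1))\<^sup>2 \<le> 1 / (4 * real (Suc m) * real (Suc (Suc m)))"
    proof (rule divide_left_mono)
      show "0 < (real (2 * Suc m + 1))\<^sup>2 * (4 * real (Suc m) * real (Suc (Suc m)))"
        by (intro mult_pos_pos zero_less_power) auto
    qed (auto simp: power2_eq_square algebra_simps)
    also have "\<dots> = 1 / (4 * real (Suc m)) - 1 / (4 * real (Suc (Suc m)))"
      using split[of "real (Suc m)"] by (simp add: add_ac)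
    finally show ?case
      using Suc by simp
  qed simp
  moreover have "0 \<le> 1 / (4 * real (Suc m))"
    by simp
  ultimately show ?thesis
    by linarith
qed

text \<open>A non-coprime pair has a common divisor that is \<open>2\<close> or odd and at least \<open>3\<close>, and
  \<open>1/4 + \<Sum> 1/(2k+1)\<^sup>2 \<le> 1/4 + \<Sum> 1/(4k(k+1)) = 1/2\<close>.\<close>

lemma card_prim_box_ge: "y\<^sup>2 \<le> 2 * card (prim_box y)"
proof -
  define Q where "Q = {1..int y} \<times> {1..int y}"
  define M where "M d = {a \<in> {1..int y}. int d dvd a}" for d
  have finM: "finite (M d)" for d
    by (rule finite_subset[of _ "{1..int y}"]) (auto simp: M_def)
  have cM: "real (card (M d \<times> M d)) \<le> (real y)\<^sup>2 * (1 / (real d)\<^sup>2)" if "d \<ge> 1" for d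
  proof -
    have "real (card (M d \<times> M d)) = (real (card (M d)))\<^sup>2"
      by (simp add: card_cartesian_product power2_eq_square)
    also have "\<dots> \<le> (real y / real d)\<^sup>2"
      unfolding M_def using card_multiples_le[OF that, of y] by (intro power_mono) auto
    finally show ?thesis
      by (simp add: power_divide)
  qed
  have sub: "Q - prim_box y \<subseteq> M 2 \<times> M 2 \<union> (\<Union>k\<in>{1..y}. M (2 * k + 1) \<times> M (2 * k + 1))"
  proof
    fix x assume x: "x \<in> Q - prim_box y"
    obtain a b where ab: "x = (a, b)"
      by fastforce
    have r: "1 \<le> a" "a \<le> int y" "1 \<le> b" "b \<le> int y"
      using x by (auto simp: Q_def ab)
    have nc: "\<not> coprime a b"
      using x r by (auto simp: ab prim_box_def prim_def ht_def)
    define g where "g = nat (gcd a b)"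
    have "int g = gcd a b"
      by (simp add: g_def)
    then have g: "int g dvd a" "int g dvd b"
      by auto
    have "g \<noteq> 1"
      using nc by (auto simp: g_def coprime_iff_gcd_eq_1)
    have "int g \<le> a"
      using g(1) r by (intro zdvd_imp_le) auto
    then have gy: "g \<le> y"
      using r by linarith
    show "x \<in> M 2 \<times> M 2 \<union> (\<Union>k\<in>{1..y}. M (2 * k + 1) \<times> M (2 * k + 1))"
    proof (cases "even g")
      case True
      then have "int 2 dvd int g"
        by (simp only: of_nat_dvd_iff)
      then have "int 2 dvd a" "int 2 dvd b"
        using g dvd_trans by blast+
      then show ?thesis
        using r by (simp add: ab M_def)
    next
      case False
      then obtain k where k: "g = 2 * k + 1"
        by (elim oddE)
      then have "k \<in> {1..y}"
        using \<open>g \<noteq> 1\<close> gy by auto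
      moreover have "x \<in> M (2 * k + 1) \<times> M (2 * k + 1)"
        using g r by (simp only: ab M_def k[symmetric]) auto
      ultimately show ?thesis
        by blast
    qed
  qed
  have "card (Q - prim_box y) \<le> card (M 2 \<times> M 2 \<union> (\<Union>k\<in>{1..y}. M (2 * k + 1) \<times> M (2 * k + 1)))"
    using finM by (intro card_mono sub) auto
  also have "\<dots> \<le> card (M 2 \<times> M 2) + card (\<Union>k\<in>{1..y}. M (2 * k + 1) \<times> M (2 * k + 1))"
    by (rule card_Un_le)
  also have "\<dots> \<le> card (M 2 \<times> M 2) + (\<Sum>k = 1..y. card (M (2 * k + 1) \<times> M (2 * k + 1)))"
    by (intro add_left_mono card_UN_le) simp
  finally have "real (card (Q - prim_box y)) \<le>
      real (card (M 2 \<times> M 2) + (\<Sum>k = 1..y. card (M (2 * k + 1) \<times> M (2 * k + 1))))"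
    by (simp only: of_nat_le_iff)
  also have "\<dots> = real (card (M 2 \<times> M 2)) + (\<Sum>k = 1..y. real (card (M (2 * k + 1) \<times> M (2 * k + 1))))"
    by (simp only: of_nat_add of_nat_sum)
  also have "\<dots> \<le> (real y)\<^sup>2 * (1 / (real 2)\<^sup>2) + (\<Sum>k = 1..y. (real y)\<^sup>2 * (1 / (real (2 * k + 1))\<^sup>2))"
    by (intro add_mono sum_mono cM) auto
  also have "\<dots> = (real y)\<^sup>2 * (1 / 4) + (real y)\<^sup>2 * (\<Sum>k = 1..y. 1 / (real (2 * k + 1))\<^sup>2)"
    by (simp only: sum_distrib_left) simp
  also have "\<dots> \<le> (real y)\<^sup>2 * (1 / 4) + (real y)\<^sup>2 * (1 / 4)"
    by (intro add_left_mono mult_left_mono sum_inverse_odd_squares_le) simp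
  finally have "real (2 * card (Q - prim_box y)) \<le> real (y\<^sup>2)"
    by simp
  then have half: "2 * card (Q - prim_box y) \<le> y\<^sup>2"
    by (simp only: of_nat_le_iff)
  have "card Q = y\<^sup>2"
    by (simp add: Q_def card_cartesian_product power2_eq_square)
  moreover have "card (Q - prim_box y) = card Q - card (prim_box y)"
    using prim_box_subset finite_prim_box by (intro card_Diff_subset) (auto simp: Q_def)
  moreover have "card (prim_box y) \<le> y\<^sup>2"
    by (rule card_prim_box_le)
  ultimately show ?thesis
    using half by linarith
qed

section \<open>Dyadic blocks and lists of primitive factors\<close>

definition dyadic_block :: "nat \<Rightarrow> (int \<times> int) set" where
  "dyadic_block j = {x \<in> prim. 2 ^ j < ht x \<and> ht x \<le> 2 ^ Suc j}"

lemma finite_dyadic_block: "finite (dyadic_block j)"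
  by (rule finite_subset[OF _ finite_prim_box[of "2 ^ Suc j"]])
    (auto simp: dyadic_block_def prim_box_def)

text \<open>The box of side \<open>2 ^ (j + 1)\<close> holds at least \<open>2 * 4 ^ j\<close>
  primitive pairs, and at most \<open>4 ^ j\<close> of them lie in the box of side
  \<open>2 ^ j\<close>.\<close>

lemma card_dyadic_block_ge: "4 ^ j \<le> card (dyadic_block j)"
proof -
  have p4: "((2::nat) ^ i)\<^sup>2 = 4 ^ i" for i
    by (simp add: power2_eq_square flip: power_mult_distrib)
  have "prim_box (2 ^ Suc j) \<subseteq> prim_box (2 ^ j) \<union> dyadic_block j"
    by (auto simp: prim_box_def dyadic_block_def)
  then have "card (prim_box (2 ^ Suc j)) \<le> card (prim_box (2 ^ j) \<union> dyadic_block j)"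
    by (intro card_mono) (auto simp: finite_prim_box finite_dyadic_block)
  also have "\<dots> \<le> card (prim_box (2 ^ j)) + card (dyadic_block j)"
    by (rule card_Un_le)
  finally show ?thesis
    using card_prim_box_le[of "2 ^ j"] card_prim_box_ge[of "2 ^ Suc j"] unfolding p4 by simp
qed

lemma dyadic_block_disjoint:
  assumes "x \<in> dyadic_block i" "x \<in> dyadic_block j"
  shows "i = j"
proof -
  have "i' \<le> j'" if "x \<in> dyadic_block i'" "x \<in> dyadic_block j'" for i' j'
  proof -
    have "(2::nat) ^ i' < 2 ^ Suc j'"
      using that by (auto simp: dyadic_block_def)
    then have "i' < Suc j'"
      by (simp only: power_strict_increasing_iff)
    then show ?thesis by simp
  qed
  then show ?thesis
    using assms by (meson antisym)
qed

definition prim_lists :: "nat \<Rightarrow> nat \<Rightarrow> (int \<times> int) list set" where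
  "prim_lists n T = {xs. length xs = n \<and> set xs \<subseteq> prim \<and> hts xs \<le> T}"

lemma finite_prim_lists: "finite (prim_lists n T)"
  by (rule finite_subset[OF _ finite_lists_upto[of n "real T"]])
    (auto simp: prim_lists_def lists_upto_def prim_def)

text \<open>With the head in block \<open>J - i\<close> and exponent \<open>i\<close> left for the
  tail, every \<open>i\<close> contributes the same power \<open>4 ^ J\<close>, and the binomials
  add up by the hockey-stick identity. Each factor adds 1 to the exponent of the height bound, as
  block \<open>j\<close> reaches up to \<open>2 ^ (j + 1)\<close>.\<close>

lemma card_prim_lists_ge:
  "4 ^ J * (n + J choose n) \<le> card (prim_lists (Suc n) (2 ^ (J + Suc n)))"
proof (induction n arbitrary: J)
  case 0
  have "card (dyadic_block J) = card ((\<lambda>x. [x]) ` dyadic_block J)"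
    by (subst card_image) (auto simp: inj_on_def)
  also have "\<dots> \<le> card (prim_lists (Suc 0) (2 ^ (J + Suc 0)))"
    by (intro card_mono finite_prim_lists) (auto simp: prim_lists_def dyadic_block_def)
  finally show ?case
    using card_dyadic_block_ge[of J] by simp
next
  case (Suc n)
  define B where "B i = (\<lambda>(x, xs). x # xs) ` (dyadic_block (J - i) \<times> prim_lists (Suc n) (2 ^ (i + Suc n)))" for i
  have finB: "finite (B i)" for i
    by (simp add: B_def finite_dyadic_block finite_prim_lists)
  have cardB: "4 ^ J * (n + i choose n) \<le> card (B i)" if "i \<le> J" for i
  proof -
    have "4 ^ J * (n + i choose n) = 4 ^ (J - i) * (4 ^ i * (n + i choose n))"
      using that by (simp flip: power_add mult.assoc)
    also have "\<dots> \<le> card (dyadic_block (J - i)) * card (prim_lists (Suc n) (2 ^ (i + Suc n)))"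
      by (intro mult_mono card_dyadic_block_ge Suc.IH) auto
    also have "\<dots> = card (B i)"
      unfolding B_def card_cartesian_product[symmetric]
      by (subst card_image) (auto simp: inj_on_def)
    finally show ?thesis .
  qed
  have disj: "B i \<inter> B j = {}" if "i \<le> J" "j \<le> J" "i \<noteq> j" for i j
    using that dyadic_block_disjoint[of _ "J - i" "J - j"] by (fastforce simp: B_def)
  have sub: "B i \<subseteq> prim_lists (Suc (Suc n)) (2 ^ (J + Suc (Suc n)))" if "i \<le> J" for i
  proof
    fix zs assume "zs \<in> B i"
    then obtain x xs where zs: "zs = x # xs" "x \<in> dyadic_block (J - i)"
      "xs \<in> prim_lists (Suc n) (2 ^ (i + Suc n))"
      by (auto simp: B_def)
    have "ht x * hts xs \<le> 2 ^ Suc (J - i) * 2 ^ (i + Suc n)"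
      using zs by (intro mult_mono) (auto simp: dyadic_block_def prim_lists_def)
    also have "\<dots> = 2 ^ (J + Suc (Suc n))"
      unfolding power_add[symmetric] using that by simp
    finally show "zs \<in> prim_lists (Suc (Suc n)) (2 ^ (J + Suc (Suc n)))"
      using zs by (auto simp: dyadic_block_def prim_lists_def)
  qed
  have "4 ^ J * (Suc n + J choose Suc n) = (\<Sum>i\<le>J. 4 ^ J * (n + i choose n))"
    using choose_rising_sum(1)[of n J] by (simp add: sum_distrib_left[symmetric])
  also have "\<dots> \<le> (\<Sum>i\<le>J. card (B i))"
    by (intro sum_mono cardB) simp
  also have "\<dots> = card (\<Union>i\<le>J. B i)"
    using finB disj by (intro card_UN_disjoint[symmetric]) auto
  also have "\<dots> \<le> card (prim_lists (Suc (Suc n)) (2 ^ (J + Suc (Suc n))))"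
    using sub by (intro card_mono finite_prim_lists) blast
  finally show ?case .
qed

section \<open>Multiplicity of a product of primitive factors\<close>

lemma card_le_mult_card_image:
  assumes "finite A" "\<And>y. y \<in> f ` A \<Longrightarrow> card {x \<in> A. f x = y} \<le> k"
  shows "card A \<le> k * card (f ` A)"
proof -
  have "A = (\<Union>y\<in>f ` A. {x \<in> A. f x = y})"
    by auto
  then have "card A \<le> (\<Sum>y\<in>f ` A. card {x \<in> A. f x = y})"
    using card_UN_le[of "f ` A" "\<lambda>y. {x \<in> A. f x = y}"] assms(1) by simp
  also have "\<dots> \<le> (\<Sum>y\<in>f ` A. k)"
    by (intro sum_mono assms(2))
  finally show ?thesis
    by (simp add: mult.commute)
qed

lemma inj_on_prim_root: "inj_on (\<lambda>x. - rat_of_int (snd x) / rat_of_int (fst x)) prim"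
proof (rule inj_onI)
  fix x y assume x: "x \<in> prim" and y: "y \<in> prim"
    and eq: "- rat_of_int (snd x) / rat_of_int (fst x) = - rat_of_int (snd y) / rat_of_int (fst y)"
  have "rat_of_int (snd x * fst y) = rat_of_int (snd y * fst x)"
    using x y eq by (simp add: prim_def field_simps)
  then have "snd x * fst y = snd y * fst x"
    by (simp only: of_int_eq_iff)
  then have "\<bar>snd x\<bar> = \<bar>snd y\<bar> \<and> \<bar>fst x\<bar> = \<bar>fst y\<bar>"
    using x y coprime_crossproduct_int[of "snd x" "fst x" "snd y" "fst y"]
    by (simp add: prim_def coprime_commute mult.commute)
  then show "x = y"
    using x y by (simp add: prim_def prod_eq_iff)
qed

lemma poly_rpoly_lin: "poly (rpoly (lin x)) z = of_int (fst x) * z + of_int (snd x)"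
  by (simp add: lin_def map_poly_pCons mult.commute)

lemma lin_prod_root:
  assumes "x \<in> set xs" "fst x \<noteq> 0"
  shows "poly (rpoly (lin_prod xs)) (- rat_of_int (snd x) / rat_of_int (fst x)) = 0"
  using assms by (induction xs) (auto simp: rpoly_mult poly_rpoly_lin)

text \<open>Every entry of a list with product \<open>p\<close> has its root among the at most
  \<open>n\<close> rational roots of \<open>p\<close>, which leaves at most \<open>n\<close>
  candidates for each of the \<open>n\<close> positions.\<close>

lemma card_lin_prod_fibre_le:
  assumes "p \<in> lin_prod ` prim_lists n T"
  shows "card {xs \<in> prim_lists n T. lin_prod xs = p} \<le> n ^ n"
proof -
  define r where "r x = - rat_of_int (snd x) / rat_of_int (fst x)" for x
  define S where "S = {x \<in> prim. poly (rpoly p) (r x) = 0}"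
  obtain xs0 where xs0: "xs0 \<in> prim_lists n T" "p = lin_prod xs0"
    using assms by blast
  then have "\<forall>x\<in>set xs0. fst x \<noteq> 0"
    by (auto simp: prim_lists_def prim_def)
  then have p: "p \<noteq> 0" "degree p = n"
    using lin_prod_degree xs0 by (auto simp: prim_lists_def)
  have rp: "rpoly p \<noteq> 0" "degree (rpoly p) = n"
    using p rpoly_eq_iff[of p 0] by (simp_all add: degree_map_poly)
  have inj: "inj_on r S"
    using inj_on_prim_root unfolding r_def by (rule inj_on_subset) (auto simp: S_def)
  have rS: "r ` S \<subseteq> {z. poly (rpoly p) z = 0}"
    by (auto simp: S_def)
  have fin: "finite {z. poly (rpoly p) z = 0}"
    using rp(1) by (rule poly_roots_finite)
  have finS: "finite S"
    using inj rS fin by (rule inj_on_finite)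
  have "card S \<le> n"
    using card_inj_on_le[OF inj rS fin] card_poly_roots_bound[OF rp(1)] rp(2) by linarith
  have "{xs \<in> prim_lists n T. lin_prod xs = p} \<subseteq> {xs. set xs \<subseteq> S \<and> length xs = n}"
  proof clarify
    fix xs assume xs: "xs \<in> prim_lists n T" "p = lin_prod xs"
    then have "x \<in> S" if "x \<in> set xs" for x
      using that lin_prod_root[OF that] by (auto simp: prim_lists_def prim_def S_def r_def)
    then show "set xs \<subseteq> S \<and> length xs = n"
      using xs by (auto simp: prim_lists_def)
  qed
  then have "card {xs \<in> prim_lists n T. lin_prod xs = p} \<le> card {xs. set xs \<subseteq> S \<and> length xs = n}"
    by (intro card_mono finite_lists_length_eq finS)
  also have "\<dots> \<le> n ^ n"
    using \<open>card S \<le> n\<close> finS by (simp add: card_lists_length_eq power_mono)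
  finally show ?thesis .
qed

section \<open>Lower bound for the number of split polynomials\<close>

lemma lin_prod_prim_lists_subset:
  assumes "real (2 ^ n * T) \<le> t"
  shows "lin_prod ` prim_lists n T \<subseteq> split_polys n t"
proof clarify
  fix xs assume xs: "xs \<in> prim_lists n T"
  then have nz: "\<forall>x\<in>set xs. fst x \<noteq> 0" and len: "length xs = n"
    by (auto simp: prim_lists_def prim_def)
  have "height (lin_prod xs) \<le> 2 ^ n * int (hts xs)"
    using height_lin_prod_le[of xs] len by simp
  also have "\<dots> \<le> 2 ^ n * int T"
    using xs by (auto simp: prim_lists_def)
  finally have "real_of_int (height (lin_prod xs)) \<le> real_of_int (2 ^ n * int T)"
    by (simp only: of_int_le_iff)
  then show "lin_prod xs \<in> split_polys n t"
    using assms lin_prod_degree[OF nz] splits_completely_lin_prod[OF nz] len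
    by (simp add: split_polys_def)
qed

text \<open>One \<open>Suc k\<close> in the exponent comes from the upper ends of the dyadic blocks,
  the other from the factor \<open>2 ^ n\<close> lost when bounding the height of the
  product.\<close>

lemma R_split_ge_binomial:
  assumes "(2::real) ^ (J + 2 * Suc k) \<le> t"
  shows "4 ^ J * (k + J choose k) \<le> Suc k ^ Suc k * R_split (Suc k) t"
proof -
  let ?A = "prim_lists (Suc k) (2 ^ (J + Suc k))"
  have "real (2 ^ Suc k * 2 ^ (J + Suc k)) = 2 ^ (Suc k + (J + Suc k))"
    by (simp only: power_add of_nat_mult of_nat_power of_nat_numeral)
  also have "Suc k + (J + Suc k) = J + 2 * Suc k"
    by simp
  finally have "real (2 ^ Suc k * 2 ^ (J + Suc k)) \<le> t"
    using assms by (rule ord_eq_le_trans)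
  then have sub: "lin_prod ` ?A \<subseteq> split_polys (Suc k) t"
    by (rule lin_prod_prim_lists_subset)
  have "4 ^ J * (k + J choose k) \<le> card ?A"
    by (rule card_prim_lists_ge)
  also have "\<dots> \<le> Suc k ^ Suc k * card (lin_prod ` ?A)"
    by (intro card_le_mult_card_image finite_prim_lists card_lin_prod_fibre_le)
  also have "\<dots> \<le> Suc k ^ Suc k * R_split (Suc k) t"
    unfolding R_split_def by (intro mult_left_mono card_mono finite_split_polys sub) simp
  finally show ?thesis .
qed

text \<open>Taking \<open>J\<close> as large as \<open>t\<close> permits makes \<open>4 ^ J\<close>
  of order \<open>t\<^sup>2\<close>, and \<open>(k + J choose k) \<ge> ((k + J) / k) ^ k\<close> is
  of order \<open>ln t ^ k\<close>.\<close>

lemma R_split_lower: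
  assumes "k \<ge> 1" "t \<ge> 1" "ln t \<ge> real (4 * Suc k + 2)"
  shows "(1 / 2 ^ (2 * Suc k + 1))\<^sup>2 * (1 / (2 * real k)) ^ k / real (Suc k ^ Suc k) * t\<^sup>2 * ln t ^ k
           \<le> real (R_split (Suc k) t)"
proof -
  define N where "N = real (Suc k ^ Suc k)"
  have N: "N > 0"
    unfolding N_def by (subst of_nat_0_less_iff) simp
  have "1 \<le> nat \<lfloor>t\<rfloor>"
    using assms(2) by (simp add: le_nat_floor)
  then obtain m where m: "2 ^ m \<le> nat \<lfloor>t\<rfloor>" "nat \<lfloor>t\<rfloor> < 2 ^ (m + 1)"
    using ex_power_ivl1[of 2 "nat \<lfloor>t\<rfloor>"] by auto
  have "real (2 ^ m) \<le> real (nat \<lfloor>t\<rfloor>)"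
    using m(1) by (simp only: of_nat_le_iff)
  also have "\<dots> \<le> t"
    using assms(2) by (intro of_nat_floor) simp
  finally have mt: "2 ^ m \<le> t"
    by simp
  have "t \<le> real (Suc (nat \<lfloor>t\<rfloor>))"
    using assms(2) by simp linarith
  also have "\<dots> \<le> real (2 ^ (m + 1))"
    using m(2) by (simp only: of_nat_le_iff Suc_le_eq)
  finally have tm: "t \<le> 2 ^ (m + 1)"
    by simp
  have "ln t \<le> ln (2 ^ (m + 1))"
    using tm assms(2) by (subst ln_le_cancel_iff) auto
  also have "\<dots> = real (m + 1) * ln 2"
    by (rule ln_realpow)
  also have "\<dots> \<le> real (m + 1) * 1"
    using ln_le_minus_one[of "2::real"] by (intro mult_left_mono) auto
  finally have lnm: "ln t \<le> real m + 1"
    by simp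
  \<comment> \<open>The subtraction does not truncate: the hypothesis on \<open>ln t\<close> forces
    \<open>m \<ge> 4 * Suc k + 1\<close>.\<close>
  define J where "J = m - 2 * Suc k"
  have J: "m = J + 2 * Suc k"
    using lnm assms(3) by (simp add: J_def)
  \<comment> \<open>From \<open>J \<ge> ln t - 1 - 2 * Suc k\<close>; the threshold
    \<open>4 * Suc k + 2\<close> is what makes this at least \<open>ln t / 2\<close>.\<close>
  have Jln: "ln t / 2 \<le> real J"
    using lnm assms(3) J by simp
  have lnt: "0 \<le> ln t"
    using assms by simp
  have "t / 2 ^ (2 * Suc k + 1) \<le> 2 ^ J"
    using tm by (simp add: J power_add field_simps)
  then have "(t / 2 ^ (2 * Suc k + 1))\<^sup>2 \<le> (2 ^ J)\<^sup>2"
    using assms by (intro power_mono) auto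
  also have "((2::real) ^ J)\<^sup>2 = 4 ^ J"
    by (simp add: power2_eq_square flip: power_mult_distrib)
  finally have four: "(t / 2 ^ (2 * Suc k + 1))\<^sup>2 \<le> 4 ^ J" .
  have "(ln t / (2 * real k)) ^ k \<le> (real (k + J) / real k) ^ k"
    using lnt Jln assms(1) by (intro power_mono) (auto simp: field_simps)
  also have "\<dots> \<le> real (k + J choose k)"
    by (rule binomial_ge_n_over_k_pow_k) simp
  finally have "(t / 2 ^ (2 * Suc k + 1))\<^sup>2 * (ln t / (2 * real k)) ^ k \<le> 4 ^ J * real (k + J choose k)"
    using four lnt by (intro mult_mono) auto
  also have "\<dots> = real (4 ^ J * (k + J choose k))"
    by simp
  also have "\<dots> \<le> real (Suc k ^ Suc k * R_split (Suc k) t)"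
    using R_split_ge_binomial[of J k t] mt J by (simp only: of_nat_le_iff)
  also have "\<dots> = N * real (R_split (Suc k) t)"
    by (simp add: N_def)
  finally have "(t / 2 ^ (2 * Suc k + 1))\<^sup>2 * (ln t / (2 * real k)) ^ k / N \<le> real (R_split (Suc k) t)"
    using N by (simp only: pos_divide_le_eq mult.commute[of N])
  then show ?thesis
    by (simp add: N_def power_divide mult_ac)
qed

theorem theorem3:
  fixes n :: nat
  assumes "n \<ge> 2"
  shows "\<exists>c1 c2 t0 :: real. c1 > 0 \<and> c2 > 0 \<and> t0 \<ge> 1 \<and>
           (\<forall>t\<ge>t0. c1 * t\<^sup>2 * (ln t) ^ (n - 1) \<le> real (R_split n t) \<and>
                   real (R_split n t) \<le> c2 * t\<^sup>2 * (ln t) ^ (n - 1))"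
proof -
  define k where "k = n - 1"
  have k: "n = Suc k" "k \<ge> 1"
    using assms by (auto simp: k_def)
  \<comment> \<open>The sum of the thresholds of the two bounds; both summands are nonnegative, so
    \<open>ln t \<ge> L\<close> yields each of them.\<close>
  define L where "L = real (4 * n + 2) + (1 + ln (fact n))"
  have f: "(0::real) \<le> ln (fact n)"
    by (simp add: fact_ge_1)
  define c1 where "c1 = (1 / 2 ^ (2 * n + 1))\<^sup>2 * (1 / (2 * real k)) ^ k / real (n ^ n)"
  define c2 :: real where "c2 = 12 ^ n * (fact n)\<^sup>2 * 2 ^ (n - 1)"
  have bounds: "c1 * t\<^sup>2 * (ln t) ^ (n - 1) \<le> real (R_split n t) \<and>
      real (R_split n t) \<le> c2 * t\<^sup>2 * (ln t) ^ (n - 1)" if t: "t \<ge> exp L" for t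
  proof -
    have "exp L \<ge> 1"
      using f by (simp add: L_def)
    then have t1: "t \<ge> 1"
      using t by linarith
    have "ln t \<ge> L"
      using t t1 by (simp add: ln_ge_iff)
    then have ln: "ln t \<ge> real (4 * Suc k + 2)" "ln t \<ge> 1 + ln (fact n)"
      using f unfolding L_def k(1)[symmetric] by linarith+
    show ?thesis
      using R_split_lower[OF k(2) t1 ln(1)] R_split_upper[OF _ t1 ln(2)] k
      unfolding c1_def c2_def by simp
  qed
  have "c1 > 0" "c2 > 0"
    using k(2) assms by (simp_all add: c1_def c2_def)
  moreover have "exp L \<ge> 1"
    using f by (simp add: L_def)
  ultimately show ?thesis
    using bounds by blast
qed

end
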